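(* Let $\alpha,\beta\in\mathbb{C}$. Let $\Gamma$ be a rectifiable path in the complex plane with endpoint $z_\ast$ such that analytic continuation along $\Gamma$ of a solution of the system $q'=p^2+zq+\alpha$, $p'=-q^2-zp-\beta$ (rewritten in the coordinates after the second blow-up) leads to a point $P$ on one of the exceptional curves $L_2^{(\rho)}$, $\rho\in\{1,\omega,\bar\omega\}$. Let $P$ have coordinates $(\hat u_{1,1},\hat u_{1,2})=(c^{-1},0)$ and $(\hat u_{2,1},\hat u_{2,2})=(0,c)$, $c\in\mathbb{C}$. Then $c=\bar\rho\alpha-\rho\beta-1$.
   Context: Here $z$ is the complex independent variable, $'=d/dz$, $\alpha,\beta$ are complex constants, $\omega=\frac{-1+i\sqrt3}{2}$, and bars denote complex conjugation, so $\bar\rho=\rho^{-1}=\rho^2$ for $\rho\in\{1,\omega,\bar\omega\}$. The phase space of $(q,p)$ is compactified to $\mathbb{CP}^2$, with a chart $(u_1,u_2)$ given by $u_1=1/q$, $u_2=p/q$ (so that $[1:q:p]=[u_1:1:u_2]$). For each $\rho\in\{1,\omega,\bar\omega\}$: First blow-up, at $(u_1,u_2)=(0,-\rho)$: one of the two new charts is $u_{2,1}=u_1$, $u_{2,2}=\frac{u_2+\rho}{u_1}$. Second blow-up, at the ($z$-dependent) point $(u_{2,1},u_{2,2})=(0,\bar\rho z)$: the two new charts are $$\hat u_{1,1}=\frac{u_{2,1}}{u_{2,2}-\bar\rho z},\quad \hat u_{1,2}=u_{2,2}-\bar\rho z,\qquad\text{and}\qquad \hat u_{2,1}=u_{2,1},\quad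 \hat u_{2,2}=\frac{u_{2,2}-\bar\rho z}{u_{2,1}}.$$ The exceptional curve $L_2^{(\rho)}$ of the second blow-up is given by $\hat u_{1,2}=0$ in the first of these charts and by $\hat u_{2,1}=0$ in the second, with $\hat u_{1,1}=\hat u_{2,2}^{-1}$ on the overlap (for $c=0$ the point lies only in the second chart). "Analytic continuation along $\Gamma$ leads to $P$" means that the solution is continued analytically along $\Gamma$ up to the endpoint $z_\ast$ and that, written in these coordinates, it tends to $P$ as $z\to z_\ast$ along $\Gamma$. *)

theory Defs
  imports "HOL-Analysis.Analysis"
begin

definition omega :: complex where
  "omega = (- 1 + \<i> * complex_of_real (sqrt 3)) / 2"

definition rectifiable_path :: "(real \<Rightarrow> complex) \<Rightarrow> bool" where
  "rectifiable_path \<gamma> \<longleftrightarrow> path \<gamma> \<and>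
     (\<exists>L. \<forall>(n::nat) (t::nat \<Rightarrow> real). mono_on {..n} t \<and> t ` {..n} \<subseteq> {0..1} \<longrightarrow>
        (\<Sum>i<n. dist (\<gamma> (t i)) (\<gamma> (t (Suc i)))) \<le> L)"

text \<open>A family of function elements along the part of a path with parameters in \<open>T\<close>: \<open>f t\<close> is
  a representative of a germ at \<open>\<gamma> t\<close>, and for \<open>s\<close> close to \<open>t\<close> the germs at \<open>\<gamma> s\<close> of \<open>f s\<close> and
  of \<open>f t\<close> agree. The value of the continued function at parameter \<open>t\<close> is \<open>f t (\<gamma> t)\<close>; when the
  path meets itself, different parameters may carry different germs at the same point.\<close>

definition analytic_continuation_along ::
    "(real \<Rightarrow> complex) \<Rightarrow> real set \<Rightarrow> (real \<Rightarrow> complex \<Rightarrow> complex) \<Rightarrow> bool" where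
  "analytic_continuation_along \<gamma> T f \<longleftrightarrow>
     (\<forall>t\<in>T. f t analytic_on {\<gamma> t}) \<and>
     (\<forall>t\<in>T. \<forall>\<^sub>F s in at t within T. \<forall>\<^sub>F z in nhds (\<gamma> s). f s z = f t z)"

definition solves_system_at ::
    "complex \<Rightarrow> complex \<Rightarrow> (complex \<Rightarrow> complex) \<Rightarrow> (complex \<Rightarrow> complex) \<Rightarrow> complex \<Rightarrow> bool" where
  "solves_system_at \<alpha> \<beta> q p z \<longleftrightarrow>
     (q has_field_derivative (p z)\<^sup>2 + z * q z + \<alpha>) (at z) \<and>
     (p has_field_derivative - (q z)\<^sup>2 - z * p z - \<beta>) (at z)"

text \<open>\<open>chart_u\<close> is meaningful for \<open>q \<noteq> 0\<close>, the two divisions by \<open>u1\<close> and \<open>u21\<close> below for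
  nonzero denominators, and \<open>hat1\<close> for \<open>u22 \<noteq> cnj \<rho> * z\<close>.\<close>

definition chart_u :: "complex \<times> complex \<Rightarrow> complex \<times> complex" where
  "chart_u = (\<lambda>(q, p). (1 / q, p / q))"

definition blowup1 :: "complex \<Rightarrow> complex \<times> complex \<Rightarrow> complex \<times> complex" where
  "blowup1 \<rho> = (\<lambda>(u1, u2). (u1, (u2 + \<rho>) / u1))"

definition hat1 :: "complex \<Rightarrow> complex \<Rightarrow> complex \<times> complex \<Rightarrow> complex \<times> complex" where
  "hat1 \<rho> z = (\<lambda>(u21, u22). (u21 / (u22 - cnj \<rho> * z), u22 - cnj \<rho> * z))"

definition hat2 :: "complex \<Rightarrow> complex \<Rightarrow> complex \<times> complex \<Rightarrow> complex \<times> complex" where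
  "hat2 \<rho> z = (\<lambda>(u21, u22). (u21, (u22 - cnj \<rho> * z) / u21))"

text \<open>\<open>(Q t, P t)\<close> tends, as \<open>t\<close> increases to 1, to the point of the exceptional curve
  \<open>L\<^sub>2\<close> (for \<open>\<rho>\<close>) with coordinates \<open>(0, c)\<close> in the chart \<open>hat2\<close>. The first conjunct says that the
  point lies in the domain of the chart, where no division by 0 takes place.\<close>

definition leads_to_L2 ::
    "complex \<Rightarrow> (real \<Rightarrow> complex) \<Rightarrow> (real \<Rightarrow> complex) \<Rightarrow> (real \<Rightarrow> complex) \<Rightarrow> complex \<Rightarrow> bool" where
  "leads_to_L2 \<rho> \<gamma> Q P c \<longleftrightarrow>
     (\<forall>\<^sub>F t in at_left 1. Q t \<noteq> 0) \<and>
     ((\<lambda>t. hat2 \<rho> (\<gamma> t) (blowup1 \<rho> (chart_u (Q t, P t)))) \<longlongrightarrow> (0, c)) (at_left 1)"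

text \<open>For \<open>c \<noteq> 0\<close> the limit point has coordinates \<open>(inverse c, 0)\<close> in the chart \<open>hat1\<close>.\<close>

lemma leads_to_L2_iff_hat1:
  assumes c: "c \<noteq> 0"
  shows "leads_to_L2 \<rho> \<gamma> Q P c \<longleftrightarrow>
     (\<forall>\<^sub>F t in at_left 1. Q t \<noteq> 0) \<and>
     ((\<lambda>t. hat1 \<rho> (\<gamma> t) (blowup1 \<rho> (chart_u (Q t, P t)))) \<longlongrightarrow> (inverse c, 0)) (at_left 1)"
proof -
  define u where "u = (\<lambda>t. 1 / Q t)"
  define w where "w = (\<lambda>t. (P t / Q t + \<rho>) / (1 / Q t) - cnj \<rho> * \<gamma> t)"
  have h2: "(\<lambda>t. hat2 \<rho> (\<gamma> t) (blowup1 \<rho> (chart_u (Q t, P t)))) = (\<lambda>t. (u t, w t / u t))"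
    by (simp add: hat2_def blowup1_def chart_u_def u_def w_def)
  have h1: "(\<lambda>t. hat1 \<rho> (\<gamma> t) (blowup1 \<rho> (chart_u (Q t, P t)))) = (\<lambda>t. (u t / w t, w t))"
    by (simp add: hat1_def blowup1_def chart_u_def u_def w_def)
  have "((\<lambda>t. (u t, w t / u t)) \<longlongrightarrow> (0, c)) (at_left 1) \<longleftrightarrow>
        ((\<lambda>t. (u t / w t, w t)) \<longlongrightarrow> (inverse c, 0)) (at_left 1)"
    if Q: "\<forall>\<^sub>F t in at_left 1. Q t \<noteq> 0"
  proof
    have u0: "\<forall>\<^sub>F t in at_left 1. u t \<noteq> 0"
      using Q by eventually_elim (simp add: u_def)
    assume "((\<lambda>t. (u t, w t / u t)) \<longlongrightarrow> (0, c)) (at_left 1)"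
    from tendsto_fst[OF this] tendsto_snd[OF this]
    have l: "(u \<longlongrightarrow> 0) (at_left 1)" "((\<lambda>t. w t / u t) \<longlongrightarrow> c) (at_left 1)"
      by simp_all
    have "((\<lambda>t. u t * (w t / u t)) \<longlongrightarrow> 0) (at_left 1)"
      using tendsto_mult[OF l] by simp
    moreover have "\<forall>\<^sub>F t in at_left 1. u t * (w t / u t) = w t"
      using u0 by eventually_elim simp
    ultimately have "(w \<longlongrightarrow> 0) (at_left 1)"
      using tendsto_cong by fastforce
    moreover have "((\<lambda>t. u t / w t) \<longlongrightarrow> inverse c) (at_left 1)"
      using tendsto_inverse[OF l(2) c] by simp
    ultimately show "((\<lambda>t. (u t / w t, w t)) \<longlongrightarrow> (inverse c, 0)) (at_left 1)"
      by (intro tendsto_Pair)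
  next
    assume "((\<lambda>t. (u t / w t, w t)) \<longlongrightarrow> (inverse c, 0)) (at_left 1)"
    from tendsto_fst[OF this] tendsto_snd[OF this]
    have l: "((\<lambda>t. u t / w t) \<longlongrightarrow> inverse c) (at_left 1)" "(w \<longlongrightarrow> 0) (at_left 1)"
      by simp_all
    have ic: "inverse c \<noteq> 0" using c by simp
    have "\<forall>\<^sub>F t in at_left 1. u t / w t \<noteq> 0"
      using tendsto_imp_eventually_ne[OF l(1) ic] .
    then have "\<forall>\<^sub>F t in at_left 1. u t / w t * w t = u t"
      by eventually_elim auto
    moreover have "((\<lambda>t. u t / w t * w t) \<longlongrightarrow> 0) (at_left 1)"
      using tendsto_mult[OF l] by simp
    ultimately have "(u \<longlongrightarrow> 0) (at_left 1)"
      using tendsto_cong by fastforce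
    moreover have "((\<lambda>t. w t / u t) \<longlongrightarrow> c) (at_left 1)"
      using tendsto_inverse[OF l(1) ic] by simp
    ultimately show "((\<lambda>t. (u t, w t / u t)) \<longlongrightarrow> (0, c)) (at_left 1)"
      by (intro tendsto_Pair)
  qed
  then show ?thesis
    unfolding leads_to_L2_def h1 h2 by blast
qed

end

theory Submission
  imports Defs "HOL-Complex_Analysis.Conformal_Mappings"
begin

text \<open>Put \<open>u = 1/q\<close>, \<open>w = q (p + \<rho> q - \<rho>\<^sup>2 z)\<close> (so that \<open>(u, w)\<close> is the second chart of the second
  blow-up) and \<open>c\<^sub>0 = \<rho>\<^sup>2 \<alpha> - \<rho> \<beta> - 1\<close>. In these coordinates
  \<open>u' = -\<rho>\<^sup>2 + O(u)\<close> and \<open>u w' = \<rho>\<^sup>2 (c\<^sub>0 - w) + O(u)\<close>, hence \<open>Y = (w - c\<^sub>0)/u\<close>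
  satisfies \<open>Y' = r/u\<close> with \<open>r\<close> a polynomial in \<open>z, u, w\<close>. If \<open>w\<close> tended to \<open>c \<noteq> c\<^sub>0\<close>,
  then \<open>Y'/Y = r/(w - c\<^sub>0)\<close> would stay bounded near the end of the path, so \<open>ln \<bar>Y\<bar>\<close>
  would be bounded because the path has finite length; but \<open>\<bar>Y\<bar> = \<bar>w - c\<^sub>0\<bar>/\<bar>u\<bar>\<close> tends to infinity.\<close>

section \<open>Real functions with local increments controlled by a rectifiable path\<close>

text \<open>The local bound only compares \<open>x\<close> itself with its neighbours, and the size
  of the neighbourhood is not uniform in \<open>x\<close>. Bisection still yields a finite chain:
  chains concatenate, and a short interval around \<open>x\<close> is served by stopping over at
  \<open>x\<close>.\<close>

lemma locally_Lipschitz_wrt_path_chain: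
  fixes F :: "real \<Rightarrow> real" and \<gamma> :: "real \<Rightarrow> 'a::metric_space"
  assumes loc: "\<And>x. x \<in> T \<Longrightarrow>
      \<forall>\<^sub>F s in at x within T. \<bar>F s - F x\<bar> \<le> M * dist (\<gamma> s) (\<gamma> x)"
    and T: "{a..b} \<subseteq> T" "is_interval T" and ab: "a \<le> b"
  shows "\<exists>n t. t 0 = a \<and> t n = b \<and>
      (\<forall>i<n. t i \<le> t (Suc i) \<and> \<bar>F (t (Suc i)) - F (t i)\<bar> \<le> M * dist (\<gamma> (t i)) (\<gamma> (t (Suc i))))"
proof -
  define E where "E x y \<longleftrightarrow> x \<le> y \<and> \<bar>F y - F x\<bar> \<le> M * dist (\<gamma> x) (\<gamma> y)" for x y
  \<comment> \<open>The membership guard is there because the short intervals in the local case of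
    \<open>Bolzano\<close> may stick out of \<open>T\<close>.\<close>
  define P where "P x y \<longleftrightarrow>
      (x \<in> T \<and> y \<in> T \<longrightarrow> (\<exists>n t. t 0 = x \<and> t n = y \<and> (\<forall>i<n. E (t i) (t (Suc i)))))"
    for x y
  have "P a b"
    using ab
  proof (induction rule: Bolzano)
    case (trans x y z)
    show ?case
      unfolding P_def
    proof (intro impI)
      assume "x \<in> T \<and> z \<in> T"
      moreover from this have "y \<in> T"
        using T(2) trans unfolding is_interval_1 by blast
      ultimately obtain n1 t1 n2 t2 where
        1: "t1 0 = x" "t1 n1 = y" "\<forall>i<n1. E (t1 i) (t1 (Suc i))" and
        2: "t2 0 = y" "t2 n2 = z" "\<forall>i<n2. E (t2 i) (t2 (Suc i))"
        using trans unfolding P_def by metis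
      define t where "t i = (if i \<le> n1 then t1 i else t2 (i - n1))" for i
      have "E (t i) (t (Suc i))" if "i < n1 + n2" for i
      proof (cases i n1 rule: linorder_cases)
        case less
        then show ?thesis using 1 by (simp add: t_def)
      next
        case equal
        then show ?thesis using 1 2(1) 2(3)[rule_format, of 0] that by (simp add: t_def)
      next
        case greater
        then have "i - n1 < n2" "Suc i - n1 = Suc (i - n1)" using that by auto
        then show ?thesis using 2 greater by (simp add: t_def)
      qed
      moreover have "t 0 = x" "t (n1 + n2) = z"
        using 1 2 by (auto simp: t_def)
      ultimately show "\<exists>n t. t 0 = x \<and> t n = z \<and> (\<forall>i<n. E (t i) (t (Suc i)))"
        by blast
    qed
  next
    case (local x)
    then have "x \<in> T" using T(1) by auto
    from loc[OF this] obtain d where d: "d > 0"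
      "\<And>s. s \<in> T \<Longrightarrow> s \<noteq> x \<Longrightarrow> dist s x < d \<Longrightarrow> \<bar>F s - F x\<bar> \<le> M * dist (\<gamma> s) (\<gamma> x)"
      unfolding eventually_at by blast
    have "P y z" if yz: "y \<le> x" "x \<le> z" "z - y < d" for y z
      unfolding P_def
    proof (intro impI)
      assume "y \<in> T \<and> z \<in> T"
      then have E: "E y x" "E x z"
        using d(2)[of y] d(2)[of z] yz
        by (cases "y = x"; cases "z = x"; simp add: E_def dist_commute abs_minus_commute dist_real_def)+
      show "\<exists>n t. t 0 = y \<and> t n = z \<and> (\<forall>i<n. E (t i) (t (Suc i)))"
        by (rule exI[of _ 2], rule exI[of _ "\<lambda>i::nat. if i = 0 then y else if i = 1 then x else z"])
           (use E in \<open>auto simp: less_Suc_eq numeral_2_eq_2\<close>)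
    qed
    then show ?case using d(1) by blast
  qed
  moreover have "a \<in> T" "b \<in> T" using T(1) ab by auto
  ultimately show ?thesis unfolding P_def E_def by blast
qed

text \<open>The parameters of a chain from \<open>a\<close> to \<open>b\<close> form a partition
  admissible in \<open>rectifiable_path\<close>, so the telescoping sum is at most
  \<open>M * L\<close>, independently of how close \<open>b\<close> is to 1.\<close>

lemma rectifiable_path_locally_Lipschitz_imp_bounded:
  fixes F :: "real \<Rightarrow> real"
  assumes \<gamma>: "rectifiable_path \<gamma>" and a: "0 \<le> a" and M: "0 \<le> M"
    and loc: "\<And>x. x \<in> {a..<1} \<Longrightarrow>
      \<forall>\<^sub>F s in at x within {a..<1}. \<bar>F s - F x\<bar> \<le> M * dist (\<gamma> s) (\<gamma> x)"
  shows "\<exists>B. \<forall>b\<in>{a..<1}. \<bar>F b - F a\<bar> \<le> B"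
proof -
  obtain L where L: "\<And>(n::nat) t. mono_on {..n} t \<Longrightarrow> t ` {..n} \<subseteq> {0..1} \<Longrightarrow>
        (\<Sum>i<n. dist (\<gamma> (t i)) (\<gamma> (t (Suc i)))) \<le> L"
    using \<gamma> unfolding rectifiable_path_def by blast
  have "\<bar>F b - F a\<bar> \<le> M * L" if b: "b \<in> {a..<1}" for b
  proof -
    have "{a..b} \<subseteq> {a..<1}" "is_interval {a..<1}" "a \<le> b"
      using b by (auto simp: is_interval_1)
    from locally_Lipschitz_wrt_path_chain[OF loc this]
    obtain n :: nat and t where t: "t 0 = a" "t n = b"
      "\<And>i. i < n \<Longrightarrow> t i \<le> t (Suc i)"
      "\<And>i. i < n \<Longrightarrow> \<bar>F (t (Suc i)) - F (t i)\<bar> \<le> M * dist (\<gamma> (t i)) (\<gamma> (t (Suc i)))"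
      by blast
    have le: "t i \<le> t j" if "i \<le> j" "j \<le> n" for i j
      using that
    proof (induction j rule: dec_induct)
      case (step m)
      then show ?case using t(3)[of m] by auto
    qed simp
    have "mono_on {..n} t" using le by (auto simp: mono_on_def)
    moreover have "t ` {..n} \<subseteq> {0..1}"
      using le[of 0] le[of _ n] t(1,2) a b by fastforce
    ultimately have sum: "(\<Sum>i<n. dist (\<gamma> (t i)) (\<gamma> (t (Suc i)))) \<le> L"
      by (rule L)
    have "F b - F a = (\<Sum>i<n. F (t (Suc i)) - F (t i))"
      using t(1,2) by (simp add: sum_lessThan_telescope[of "\<lambda>i. F (t i)"])
    then have "\<bar>F b - F a\<bar> \<le> (\<Sum>i<n. \<bar>F (t (Suc i)) - F (t i)\<bar>)"
      by (simp add: sum_abs)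
    also have "\<dots> \<le> (\<Sum>i<n. M * dist (\<gamma> (t i)) (\<gamma> (t (Suc i))))"
      by (intro sum_mono t(4)) auto
    also have "\<dots> \<le> M * L"
      using mult_left_mono[OF sum M] by (simp add: sum_distrib_left)
    finally show ?thesis .
  qed
  then show ?thesis by blast
qed

section \<open>Logarithmic derivatives\<close>

lemma ln_norm_locally_Lipschitz:
  fixes y :: "complex \<Rightarrow> complex"
  assumes y: "(y has_field_derivative D) (at z0)" "y z0 \<noteq> 0"
    and D: "norm D < M * norm (y z0)"
  shows "\<forall>\<^sub>F z in nhds z0. \<bar>ln (norm (y z)) - ln (norm (y z0))\<bar> \<le> M * dist z z0"
proof -
  \<comment> \<open>Dividing by \<open>y z0\<close> moves the argument of \<open>Ln\<close> to 1 at
    \<open>z0\<close>, away from the branch cut, so \<open>G\<close> is differentiable there with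
    the logarithmic derivative of \<open>y\<close> as its derivative.\<close>
  define G where "G z = Ln (y z / y z0)" for z
  have "(G has_field_derivative D / y z0) (at z0)"
    unfolding G_def using y by (auto intro!: derivative_eq_intros simp: complex_nonpos_Reals_iff)
  then have "((\<lambda>z. (G z - G z0) / (z - z0)) \<longlongrightarrow> D / y z0) (at z0)"
    by (simp add: has_field_derivative_iff)
  moreover have "norm (D / y z0) < M"
    using D y(2) by (simp add: norm_divide divide_simps)
  ultimately have "\<forall>\<^sub>F z in at z0. norm ((G z - G z0) / (z - z0)) < M"
    using order_tendstoD(2)[OF tendsto_norm] by blast
  moreover have "\<forall>\<^sub>F z in at z0. y z \<noteq> 0"
    using DERIV_isCont[OF y(1)] y(2) unfolding isCont_def by (rule tendsto_imp_eventually_ne)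
  moreover have "\<forall>\<^sub>F z in at z0. z \<noteq> z0"
    by (simp add: eventually_at_filter)
  ultimately have "\<forall>\<^sub>F z in at z0. \<bar>ln (norm (y z)) - ln (norm (y z0))\<bar> \<le> M * dist z z0"
  proof eventually_elim
    case (elim z)
    have "ln (norm (y z)) - ln (norm (y z0)) = Re (G z - G z0)"
      using elim y(2) by (simp add: G_def norm_divide ln_div)
    then have "\<bar>ln (norm (y z)) - ln (norm (y z0))\<bar> \<le> norm (G z - G z0)"
      by (metis abs_Re_le_cmod)
    also have "\<dots> \<le> M * dist z z0"
      using elim by (simp add: norm_divide dist_norm divide_simps split: if_splits)
    finally show ?case .
  qed
  then show ?thesis
    by (simp add: eventually_nhds_conv_at)
qed

section \<open>Permanence of the differential system under analytic continuation\<close>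

text \<open>Identity theorem: in each equation both sides are holomorphic on the ball and agree near
  \<open>z1\<close>.\<close>

lemma solves_system_continuation_ball:
  assumes q: "q holomorphic_on ball z0 e" and p: "p holomorphic_on ball z0 e"
    and z1: "z1 \<in> ball z0 e" "\<forall>\<^sub>F z in nhds z1. solves_system_at \<alpha> \<beta> q p z"
    and z: "z \<in> ball z0 e"
  shows "solves_system_at \<alpha> \<beta> q p z"
proof -
  have "\<forall>\<^sub>F z in nhds z1. z \<in> ball z0 e \<and> solves_system_at \<alpha> \<beta> q p z"
    using z1 by (intro eventually_conj eventually_nhds_in_open) auto
  then obtain U where U: "open U" "z1 \<in> U" "U \<subseteq> ball z0 e"
    "\<And>z. z \<in> U \<Longrightarrow> solves_system_at \<alpha> \<beta> q p z"
    unfolding eventually_nhds by blast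
  note cont = analytic_continuation_open[OF U(1) open_ball _ connected_ball U(3) _ _ _ z]
  have ne: "U \<noteq> {}" using U(2) by auto
  have hol: "deriv q holomorphic_on ball z0 e" "deriv p holomorphic_on ball z0 e"
    "(\<lambda>z. (p z)\<^sup>2 + z * q z + \<alpha>) holomorphic_on ball z0 e"
    "(\<lambda>z. - (q z)\<^sup>2 - z * p z - \<beta>) holomorphic_on ball z0 e"
    by (intro holomorphic_intros holomorphic_deriv q p open_ball)+
  note cont = analytic_continuation_open[OF U(1) open_ball ne connected_ball U(3) _ _ _ z]
  have "deriv q z = (p z)\<^sup>2 + z * q z + \<alpha>"
    by (rule cont[OF hol(1,3)]) (use U(4) in \<open>auto simp: solves_system_at_def intro: DERIV_imp_deriv\<close>)
  moreover have "deriv p z = - (q z)\<^sup>2 - z * p z - \<beta>"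
    by (rule cont[OF hol(2,4)]) (use U(4) in \<open>auto simp: solves_system_at_def intro: DERIV_imp_deriv\<close>)
  ultimately show ?thesis
    using holomorphic_derivI[OF q open_ball z] holomorphic_derivI[OF p open_ball z]
    by (simp add: solves_system_at_def)
qed

lemma solves_system_cong:
  assumes "\<forall>\<^sub>F z in nhds x. q z = q' z" "\<forall>\<^sub>F z in nhds x. p z = p' z"
    and "solves_system_at \<alpha> \<beta> q p x"
  shows "solves_system_at \<alpha> \<beta> q' p' x"
  using assms DERIV_cong_ev[OF refl assms(1) refl] DERIV_cong_ev[OF refl assms(2) refl]
    eventually_nhds_x_imp_x[OF assms(1)] eventually_nhds_x_imp_x[OF assms(2)]
  by (simp add: solves_system_at_def)

lemma eventually_solves_system_cong:
  assumes q: "\<forall>\<^sub>F z in nhds x. q z = q' z" and p: "\<forall>\<^sub>F z in nhds x. p z = p' z"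
    and s: "\<forall>\<^sub>F z in nhds x. solves_system_at \<alpha> \<beta> q p z"
  shows "\<forall>\<^sub>F z in nhds x. solves_system_at \<alpha> \<beta> q' p' z"
proof -
  have "\<forall>\<^sub>F y in nhds x. \<forall>\<^sub>F z in nhds y. q z = q' z"
       "\<forall>\<^sub>F y in nhds x. \<forall>\<^sub>F z in nhds y. p z = p' z"
    using q p by (simp_all add: eventually_eventually)
  then show ?thesis
    using s by eventually_elim (rule solves_system_cong)
qed

text \<open>Whether the germs at parameter \<open>t\<close> solve the system is locally constant in
  \<open>t\<close>, hence constant on the connected set \<open>T\<close>.\<close>

lemma solves_system_along_path:
  assumes T: "connected T" "t0 \<in> T" "t \<in> T" and \<gamma>: "continuous_on T \<gamma>"
    and q: "analytic_continuation_along \<gamma> T q"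
    and p: "analytic_continuation_along \<gamma> T p"
    and init: "\<forall>\<^sub>F z in nhds (\<gamma> t0). solves_system_at \<alpha> \<beta> (q t0) (p t0) z"
  shows "\<forall>\<^sub>F z in nhds (\<gamma> t). solves_system_at \<alpha> \<beta> (q t) (p t) z"
proof (rule connected_induction_simple[OF T,
      where P = "\<lambda>t. \<forall>\<^sub>F z in nhds (\<gamma> t). solves_system_at \<alpha> \<beta> (q t) (p t) z"])
  fix x assume x: "x \<in> T"
  obtain e where e: "e > 0" "q x holomorphic_on ball (\<gamma> x) e" "p x holomorphic_on ball (\<gamma> x) e"
  proof -
    obtain e1 e2 where "e1 > 0" "e2 > 0"
      "q x holomorphic_on ball (\<gamma> x) e1" "p x holomorphic_on ball (\<gamma> x) e2"
      using q p x unfolding analytic_continuation_along_def analytic_at_ball by blast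
    then show ?thesis
      by (intro that[of "min e1 e2"]) (auto intro: holomorphic_on_subset)
  qed
  have "\<forall>\<^sub>F s in at x within T. \<gamma> s \<in> ball (\<gamma> x) e"
    using \<gamma> x e(1) unfolding continuous_on_def
    by (metis centre_in_ball open_ball topological_tendstoD)
  moreover have "\<forall>\<^sub>F s in at x within T. \<forall>\<^sub>F z in nhds (\<gamma> s). q s z = q x z"
       "\<forall>\<^sub>F s in at x within T. \<forall>\<^sub>F z in nhds (\<gamma> s). p s z = p x z"
    using q p x unfolding analytic_continuation_along_def by auto
  ultimately have "\<forall>\<^sub>F s in at x within T. \<gamma> s \<in> ball (\<gamma> x) e \<and>
      (\<forall>\<^sub>F z in nhds (\<gamma> s). q s z = q x z) \<and> (\<forall>\<^sub>F z in nhds (\<gamma> s). p s z = p x z)"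
    by eventually_elim auto
  then obtain d where "d > 0" and near: "\<And>s. s \<in> T \<Longrightarrow> s \<noteq> x \<Longrightarrow> dist s x < d \<Longrightarrow> \<gamma> s \<in> ball (\<gamma> x) e \<and>
      (\<forall>\<^sub>F z in nhds (\<gamma> s). q s z = q x z) \<and> (\<forall>\<^sub>F z in nhds (\<gamma> s). p s z = p x z)"
    unfolding eventually_at by blast
  \<comment> \<open>The filter \<open>at x within T\<close> leaves out \<open>s = x\<close>, where
    the claim is trivial.\<close>
  have d: "\<gamma> s \<in> ball (\<gamma> x) e \<and>
      (\<forall>\<^sub>F z in nhds (\<gamma> s). q s z = q x z) \<and> (\<forall>\<^sub>F z in nhds (\<gamma> s). p s z = p x z)"
    if "s \<in> T" "dist s x < d" for s
    using e(1) near[of s] that by (cases "s = x") auto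
  show "\<exists>W. openin (top_of_set T) W \<and> x \<in> W \<and>
      (\<forall>s\<in>W. \<forall>s'\<in>W. (\<forall>\<^sub>F z in nhds (\<gamma> s). solves_system_at \<alpha> \<beta> (q s) (p s) z) \<longrightarrow>
         (\<forall>\<^sub>F z in nhds (\<gamma> s'). solves_system_at \<alpha> \<beta> (q s') (p s') z))"
  proof (intro exI[of _ "T \<inter> ball x d"] conjI ballI impI)
    fix s s' assume s: "s \<in> T \<inter> ball x d" and s': "s' \<in> T \<inter> ball x d"
      and S: "\<forall>\<^sub>F z in nhds (\<gamma> s). solves_system_at \<alpha> \<beta> (q s) (p s) z"
    have ds: "\<gamma> s \<in> ball (\<gamma> x) e"
      "\<forall>\<^sub>F z in nhds (\<gamma> s). q s z = q x z" "\<forall>\<^sub>F z in nhds (\<gamma> s). p s z = p x z"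
      and ds': "\<gamma> s' \<in> ball (\<gamma> x) e"
      "\<forall>\<^sub>F z in nhds (\<gamma> s'). q x z = q s' z" "\<forall>\<^sub>F z in nhds (\<gamma> s'). p x z = p s' z"
      using d[of s] d[of s'] s s' by (auto simp: dist_commute eq_commute)
    \<comment> \<open>The germs at \<open>s\<close> and \<open>s'\<close> are compared through the
      representatives \<open>q x\<close> and \<open>p x\<close>, which are holomorphic on one ball
      containing both \<open>\<gamma> s\<close> and \<open>\<gamma> s'\<close>.\<close>
    have "\<And>z. z \<in> ball (\<gamma> x) e \<Longrightarrow> solves_system_at \<alpha> \<beta> (q x) (p x) z"
      using solves_system_continuation_ball[OF e(2,3) ds(1)]
        eventually_solves_system_cong[OF ds(2,3) S] by blast
    then have "\<forall>\<^sub>F z in nhds (\<gamma> s'). solves_system_at \<alpha> \<beta> (q x) (p x) z"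
      using ds'(1) open_ball unfolding eventually_nhds by blast
    then show "\<forall>\<^sub>F z in nhds (\<gamma> s'). solves_system_at \<alpha> \<beta> (q s') (p s') z"
      by (rule eventually_solves_system_cong[OF ds'(2,3)])
  qed (use x \<open>d > 0\<close> in \<open>auto simp: openin_open_Int\<close>)
qed (rule init)

section \<open>The derivative of \<open>Y\<close> in the blow-up coordinates\<close>

text \<open>The differentiated function is \<open>Y = (w - c0) / u\<close>, written without
  denominators. The shift \<open>c0\<close> is the one for which the terms of order
  \<open>q^2\<close> in the derivative cancel, leaving \<open>q\<close> times a polynomial in
  \<open>z\<close>, \<open>u\<close>, \<open>w\<close>.\<close>

lemma has_field_derivative_shifted_chart_quotient:
  fixes q p :: "complex \<Rightarrow> complex" and z \<alpha> \<beta> \<rho> :: complex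
  assumes sol: "solves_system_at \<alpha> \<beta> q p z" and q: "q z \<noteq> 0" and \<rho>: "\<rho> ^ 3 = 1"
  defines "c0 \<equiv> \<rho>\<^sup>2 * \<alpha> - \<rho> * \<beta> - 1"
    and "w \<equiv> q z * (p z + \<rho> * q z - \<rho>\<^sup>2 * z)"
    and "u \<equiv> 1 / q z"
  shows "((\<lambda>x. (q x)\<^sup>2 * (p x + \<rho> * q x - \<rho>\<^sup>2 * x) - c0 * q x) has_field_derivative
      q z * ((c0 - w) * z + \<rho> * u * w\<^sup>2 +
             (c0 - 2 * w) * u * (2 * \<rho> * w - (\<rho>\<^sup>2 * z + u * w)\<^sup>2 - \<alpha>))) (at z)"
proof -
  have d: "(q has_field_derivative (p z)\<^sup>2 + z * q z + \<alpha>) (at z)"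
       "(p has_field_derivative - (q z)\<^sup>2 - z * p z - \<beta>) (at z)"
    using sol by (auto simp: solves_system_at_def)
  define v where "v = p z + \<rho> * q z - \<rho>\<^sup>2 * z"
  have w: "w = q z * v" and v: "u * w = v" and p: "p z = v - \<rho> * q z + \<rho>\<^sup>2 * z" and u: "u * q z = 1"
    using q by (simp_all add: w_def v_def u_def)
  define g where "g = 2 * \<rho> * w - (\<rho>\<^sup>2 * z + u * w)\<^sup>2 - \<alpha>"
  \<comment> \<open>The powers of \<open>q\<close> are split off; \<open>g\<close> collects what
    stays bounded when \<open>z\<close>, \<open>u\<close>, \<open>w\<close> do.\<close>
  have q': "(p z)\<^sup>2 + z * q z + \<alpha> = \<rho>\<^sup>2 * (q z)\<^sup>2 - z * q z - g"
    using \<rho> unfolding g_def v unfolding p w by algebra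
  \<comment> \<open>The left-hand side is the derivative of \<open>v\<close>. Since
    \<open>\<rho> ^ 3 = 1\<close>, the terms in \<open>q^2\<close> and \<open>z * q\<close> cancel,
    and the remaining constant is \<open>\<rho>\<^sup>2 * c0\<close>: this is where
    \<open>c0\<close> comes from.\<close>
  have v': "- (q z)\<^sup>2 - z * p z - \<beta> + \<rho> * (\<rho>\<^sup>2 * (q z)\<^sup>2 - z * q z - g) - \<rho>\<^sup>2 =
      \<rho>\<^sup>2 * c0 - 2 * \<rho>\<^sup>2 * w + z * v + \<rho> * v\<^sup>2"
    using \<rho> unfolding g_def v c0_def unfolding p by algebra
  \<comment> \<open>Product rule for \<open>q^2 * v - c0 * q\<close>; after substitution the
    coefficient of \<open>q^2\<close> is \<open>2 * \<rho>\<^sup>2 * w + \<rho>\<^sup>2 * (c0 - 2 *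
    w) - \<rho>\<^sup>2 * c0 = 0\<close>.\<close>
  have "2 * q z * ((p z)\<^sup>2 + z * q z + \<alpha>) * v +
      (q z)\<^sup>2 * (- (q z)\<^sup>2 - z * p z - \<beta> + \<rho> * ((p z)\<^sup>2 + z * q z + \<alpha>) - \<rho>\<^sup>2) -
      c0 * ((p z)\<^sup>2 + z * q z + \<alpha>) =
      q z * (c0 - w) * z + \<rho> * w\<^sup>2 + (c0 - 2 * w) * g"
    unfolding q' v' w by algebra
  also have "\<dots> = q z * ((c0 - w) * z + \<rho> * u * w\<^sup>2 + (c0 - 2 * w) * u * g)"
    using u by algebra
  finally have "2 * q z * ((p z)\<^sup>2 + z * q z + \<alpha>) * v +
      (q z)\<^sup>2 * (- (q z)\<^sup>2 - z * p z - \<beta> + \<rho> * ((p z)\<^sup>2 + z * q z + \<alpha>) - \<rho>\<^sup>2) -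
      c0 * ((p z)\<^sup>2 + z * q z + \<alpha>) =
      q z * ((c0 - w) * z + \<rho> * u * w\<^sup>2 + (c0 - 2 * w) * u * g)" .
  then show ?thesis
    unfolding g_def[symmetric] by (auto intro!: derivative_eq_intros d simp: v_def mult_ac)
qed

lemma cube_root_of_unity_cnj:
  assumes "\<rho> \<in> {1, omega, cnj omega}"
  shows "\<rho> ^ 3 = 1" "cnj \<rho> = \<rho>\<^sup>2"
proof -
  have "omega ^ 3 = 1" "cnj omega = omega\<^sup>2"
    by (simp_all add: omega_def complex_eq_iff power3_eq_cube power2_eq_square field_simps)
  moreover from this have "cnj omega ^ 3 = 1" "cnj (cnj omega) = (cnj omega)\<^sup>2"
    by (metis complex_cnj_one complex_cnj_power, metis complex_cnj_power)
  ultimately show "\<rho> ^ 3 = 1" "cnj \<rho> = \<rho>\<^sup>2"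
    using assms by auto
qed

section \<open>The limit value, by contradiction\<close>

theorem lemma3:
  fixes \<alpha> \<beta> \<rho> c :: complex
    and \<gamma> :: "real \<Rightarrow> complex"
    and q p :: "real \<Rightarrow> complex \<Rightarrow> complex"
  assumes "\<rho> \<in> {1, omega, cnj omega}"
    and "rectifiable_path \<gamma>"
    and "\<forall>\<^sub>F z in nhds (\<gamma> 0). solves_system_at \<alpha> \<beta> (q 0) (p 0) z"
    and "analytic_continuation_along \<gamma> {0..<1} q"
    and "analytic_continuation_along \<gamma> {0..<1} p"
    and "leads_to_L2 \<rho> \<gamma> (\<lambda>t. q t (\<gamma> t)) (\<lambda>t. p t (\<gamma> t)) c"
  shows "c = cnj \<rho> * \<alpha> - \<rho> * \<beta> - 1"
proof (rule ccontr)
  note \<rho> = cube_root_of_unity_cnj[OF assms(1)]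
  define c0 where "c0 = \<rho>\<^sup>2 * \<alpha> - \<rho> * \<beta> - 1"
  assume "c \<noteq> cnj \<rho> * \<alpha> - \<rho> * \<beta> - 1"
  then have c: "c \<noteq> c0" by (simp add: c0_def \<rho>)
  have cont: "continuous_on {0..1} \<gamma>"
    using assms(2) by (simp add: rectifiable_path_def path_def)
  define u where "u t = 1 / q t (\<gamma> t)" for t
  define w where "w t = q t (\<gamma> t) * (p t (\<gamma> t) + \<rho> * q t (\<gamma> t) - \<rho>\<^sup>2 * \<gamma> t)" for t
  define r where "r t = (c0 - w t) * \<gamma> t + \<rho> * u t * (w t)\<^sup>2 +
      (c0 - 2 * w t) * u t * (2 * \<rho> * w t - (\<rho>\<^sup>2 * \<gamma> t + u t * w t)\<^sup>2 - \<alpha>)" for t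
  define Y where "Y t z = (q t z)\<^sup>2 * (p t z + \<rho> * q t z - \<rho>\<^sup>2 * z) - c0 * q t z" for t z
  have Yw: "Y t (\<gamma> t) = q t (\<gamma> t) * (w t - c0)" for t
    by (simp add: Y_def w_def algebra_simps power2_eq_square)

  have Q: "\<forall>\<^sub>F t in at_left 1. q t (\<gamma> t) \<noteq> 0"
    and lim: "((\<lambda>t. hat2 \<rho> (\<gamma> t) (blowup1 \<rho> (chart_u (q t (\<gamma> t), p t (\<gamma> t))))) \<longlongrightarrow> (0, c)) (at_left 1)"
    using assms(6) unfolding leads_to_L2_def by auto
  have u0: "(u \<longlongrightarrow> 0) (at_left 1)"
    using tendsto_fst[OF lim] by (simp add: hat2_def blowup1_def chart_u_def u_def[abs_def])
  have "((\<lambda>t. ((p t (\<gamma> t) / q t (\<gamma> t) + \<rho>) / (1 / q t (\<gamma> t)) - cnj \<rho> * \<gamma> t) / (1 / q t (\<gamma> t)))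
      \<longlongrightarrow> c) (at_left 1)"
    using tendsto_snd[OF lim] by (simp add: hat2_def blowup1_def chart_u_def)
  moreover have "\<forall>\<^sub>F t in at_left 1.
      ((p t (\<gamma> t) / q t (\<gamma> t) + \<rho>) / (1 / q t (\<gamma> t)) - cnj \<rho> * \<gamma> t) / (1 / q t (\<gamma> t)) = w t"
    using Q by eventually_elim (simp add: w_def \<rho> field_simps)
  ultimately have wc: "(w \<longlongrightarrow> c) (at_left 1)"
    by (rule Lim_transform_eventually)
  have \<gamma>1: "(\<gamma> \<longlongrightarrow> \<gamma> 1) (at_left 1)"
    using cont by (auto intro: continuous_on_Icc_at_leftD)
  \<comment> \<open>The vanishing terms are kept so that \<open>R\<close> has the shape of
    \<open>r\<close> with \<open>u = 0\<close>; its value is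
    \<open>(c0 - c) * \<gamma> 1\<close>.\<close>
  define R where "R = (c0 - c) * \<gamma> 1 + \<rho> * 0 * c\<^sup>2 +
      (c0 - 2 * c) * 0 * (2 * \<rho> * c - (\<rho>\<^sup>2 * \<gamma> 1 + 0 * c)\<^sup>2 - \<alpha>)"
  \<comment> \<open>The quotient is the limit of the modulus of \<open>r / (w - c0)\<close>, the
    logarithmic derivative of \<open>Y\<close>; the added 1 makes the later bounds strict.\<close>
  define M where "M = norm R / norm (c - c0) + 1"
  have M: "M \<ge> 0" by (simp add: M_def)
  have "(r \<longlongrightarrow> R) (at_left 1)"
    unfolding r_def[abs_def] R_def by (intro tendsto_intros wc u0 \<gamma>1)
  then have "((\<lambda>t. norm (r t) / norm (w t - c0)) \<longlongrightarrow> norm R / norm (c - c0)) (at_left 1)"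
    using c by (intro tendsto_intros wc) auto
  then have "\<forall>\<^sub>F t in at_left 1. norm (r t) / norm (w t - c0) < M"
    by (rule order_tendstoD) (simp add: M_def)
  moreover have "\<forall>\<^sub>F t in at_left 1. w t \<noteq> c0"
    using wc c by (rule tendsto_imp_eventually_ne)
  moreover have "\<forall>\<^sub>F t in at_left (1::real). t > 0"
    by (rule eventually_at_leftI[of 0]) auto
  ultimately have "\<forall>\<^sub>F t in at_left 1. t > 0 \<and> q t (\<gamma> t) \<noteq> 0 \<and> w t \<noteq> c0 \<and>
      norm (r t) < M * norm (w t - c0)"
    using Q by eventually_elim (auto simp: divide_simps split: if_splits)
  then obtain b where b: "b < 1" "\<And>t. b < t \<Longrightarrow> t < 1 \<Longrightarrow> t > 0 \<and> q t (\<gamma> t) \<noteq> 0 \<and> w t \<noteq> c0 \<and>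
      norm (r t) < M * norm (w t - c0)"
    unfolding eventually_at_left_field by blast
  \<comment> \<open>A midpoint, so that the estimates valid strictly to the right of
    \<open>b\<close> also hold at the starting point \<open>a\<close>.\<close>
  define a where "a = (b + 1) / 2"
  have a: "b < a" "a < 1" using b(1) by (auto simp: a_def)
  have a0: "0 < a" using b(2)[OF a] by simp

  define F where "F t = ln (norm (Y t (\<gamma> t)))" for t
  have "\<exists>B. \<forall>t\<in>{a..<1}. \<bar>F t - F a\<bar> \<le> B"
  proof (rule rectifiable_path_locally_Lipschitz_imp_bounded[OF assms(2) _ M])
    show "0 \<le> a" using a0 by simp
    fix x assume x: "x \<in> {a..<1}"
    then have x01: "x \<in> {0..<1}" using a0 by auto
    have bx: "q x (\<gamma> x) \<noteq> 0" "w x \<noteq> c0" "norm (r x) < M * norm (w x - c0)"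
      using b(2)[of x] a x by auto
    have "\<forall>\<^sub>F z in nhds (\<gamma> x). solves_system_at \<alpha> \<beta> (q x) (p x) z"
      by (rule solves_system_along_path[OF _ _ x01 _ assms(4,5,3)])
         (auto intro: continuous_on_subset[OF cont])
    then have "solves_system_at \<alpha> \<beta> (q x) (p x) (\<gamma> x)"
      by (rule eventually_nhds_x_imp_x)
    from has_field_derivative_shifted_chart_quotient[OF this bx(1) \<rho>(1)]
    have D: "(Y x has_field_derivative q x (\<gamma> x) * r x) (at (\<gamma> x))"
      by (simp add: Y_def[abs_def] r_def w_def u_def c0_def)
    have near: "\<forall>\<^sub>F z in nhds (\<gamma> x). \<bar>ln (norm (Y x z)) - ln (norm (Y x (\<gamma> x)))\<bar> \<le> M * dist z (\<gamma> x)"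
      by (rule ln_norm_locally_Lipschitz[OF D]) (use bx in \<open>auto simp: Yw norm_mult\<close>)
    have sub: "at x within {a..<1} \<le> at x within {0..<1}"
      using a0 by (intro at_le) auto
    have "(\<gamma> \<longlongrightarrow> \<gamma> x) (at x within {a..<1})"
      using continuous_on_subset[OF cont, of "{a..<1}"] x a0 by (simp add: continuous_on_def subset_eq)
    then have "\<forall>\<^sub>F s in at x within {a..<1}.
        \<bar>ln (norm (Y x (\<gamma> s))) - ln (norm (Y x (\<gamma> x)))\<bar> \<le> M * dist (\<gamma> s) (\<gamma> x)"
      using near by (rule eventually_compose_filterlim[rotated])
    moreover have "\<forall>\<^sub>F s in at x within {a..<1}. \<forall>\<^sub>F z in nhds (\<gamma> s). q s z = q x z"
         "\<forall>\<^sub>F s in at x within {a..<1}. \<forall>\<^sub>F z in nhds (\<gamma> s). p s z = p x z"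
      using assms(4,5) x01 filter_leD[OF sub] unfolding analytic_continuation_along_def by auto
    ultimately show "\<forall>\<^sub>F s in at x within {a..<1}. \<bar>F s - F x\<bar> \<le> M * dist (\<gamma> s) (\<gamma> x)"
    proof eventually_elim
      case (elim s)
      \<comment> \<open>\<open>F s\<close> is computed with the germ at \<open>s\<close>, while
        \<open>near\<close> concerns the one at \<open>x\<close>; both take the same value at
        \<open>\<gamma> s\<close>.\<close>
      have "Y s (\<gamma> s) = Y x (\<gamma> s)"
        using elim(2,3)[THEN eventually_nhds_x_imp_x] by (simp add: Y_def)
      then show ?case using elim(1) by (simp add: F_def)
    qed
  qed
  then obtain B where B: "\<And>t. t \<in> {a..<1} \<Longrightarrow> \<bar>F t - F a\<bar> \<le> B" by blast

  \<comment> \<open>This quotient is the reciprocal of the norm of \<open>Y\<close>. It tends to 0,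
    whereas \<open>F t \<le> F a + B\<close> keeps it at or above
    \<open>exp (- (F a + B))\<close>.\<close>
  have "((\<lambda>t. norm (u t) / norm (w t - c0)) \<longlongrightarrow> norm (0::complex) / norm (c - c0)) (at_left 1)"
    using c by (intro tendsto_intros u0 wc) auto
  then have "\<forall>\<^sub>F t in at_left 1. norm (u t) / norm (w t - c0) < exp (- (F a + B))"
    by (intro order_tendstoD(2)) auto
  moreover have "\<forall>\<^sub>F t in at_left 1. t \<in> {a<..<1}"
    by (rule eventually_at_left_real[OF a(2)])
  ultimately have "\<forall>\<^sub>F t in at_left (1::real). False"
  proof eventually_elim
    case (elim t)
    then have bt: "q t (\<gamma> t) \<noteq> 0" "w t \<noteq> c0" using b(2)[of t] a by auto
    have "exp (- F t) = norm (u t) / norm (w t - c0)"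
      using bt by (simp add: F_def Yw u_def exp_minus norm_mult norm_divide zero_less_mult_iff divide_inverse norm_inverse mult_ac)
    with elim have "exp (- F t) < exp (- (F a + B))" by simp
    then have "- F t < - (F a + B)" by (rule exp_less_cancel)
    then show False using B[of t] elim by auto
  qed
  then show False by simp
qed

end
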